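(* For any integer $n\geq 1$, $$\Phi(C_{2n+1})= \binom{n+1}{2}.$$
   Context: $C_m$ denotes the cycle with vertices $0,1,\dots,m-1$ and edges $\{i,i+1 \bmod m\}$. For a connected graph $G$, a path system of $G$ is a set consisting of one chosen path in $G$ connecting $a$ and $b$ for each unordered pair $\{a,b\}$ of distinct vertices. A global packing of $(G,\mathcal{P})$ is a map $\omega:\mathcal{P}\to\{1,\dots,k\}$ such that $\omega(P)\neq\omega(P')$ whenever distinct paths $P,P'\in\mathcal{P}$ share at least one edge; $\Phi(G,\mathcal{P})$ is the minimum such $k$, and $\Phi(G)$ is the minimum of $\Phi(G,\mathcal{P})$ over all path systems of $G$. *)

theory Defs
  imports Main "HOL-Library.FuncSet"
begin

text \<open>A simple graph is a pair of a vertex set and a set of two-element edges.\<close>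

type_synonym 'a graph = "'a set \<times> 'a set set"

abbreviation verts :: "'a graph \<Rightarrow> 'a set" where
  "verts \<equiv> fst"

abbreviation edges :: "'a graph \<Rightarrow> 'a set set" where
  "edges \<equiv> snd"

definition subgraph :: "'a graph \<Rightarrow> 'a graph \<Rightarrow> bool" where
  "subgraph H G \<longleftrightarrow> verts H \<subseteq> verts G \<and> edges H \<subseteq> edges G"

text \<open>
  Paths are undirected: a path is a subgraph, not a vertex sequence, so that traversing it
  in the opposite direction gives the same path.
\<close>

definition path_of :: "'a list \<Rightarrow> 'a graph" where
  "path_of xs = (set xs, {{xs ! i, xs ! Suc i} | i. Suc i < length xs})"

definition connecting_path :: "'a graph \<Rightarrow> 'a \<Rightarrow> 'a \<Rightarrow> 'a graph \<Rightarrow> bool" where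
  "connecting_path G a b P \<longleftrightarrow>
     (\<exists>xs. xs \<noteq> [] \<and> distinct xs \<and> hd xs = a \<and> last xs = b \<and> P = path_of xs \<and> subgraph P G)"

definition vertex_pairs :: "'a graph \<Rightarrow> 'a set set" where
  "vertex_pairs G = {{a, b} | a b. a \<in> verts G \<and> b \<in> verts G \<and> a \<noteq> b}"

text \<open>The function \<open>p\<close> chooses the path for each unordered pair. Path systems exist iff \<open>G\<close> is connected.\<close>

definition path_system :: "'a graph \<Rightarrow> 'a graph set \<Rightarrow> bool" where
  "path_system G \<P> \<longleftrightarrow>
     (\<exists>p. (\<forall>a\<in>verts G. \<forall>b\<in>verts G. a \<noteq> b \<longrightarrow> connecting_path G a b (p {a, b})) \<and>
          \<P> = p ` vertex_pairs G)"

definition global_packing :: "'a graph set \<Rightarrow> nat \<Rightarrow> ('a graph \<Rightarrow> nat) \<Rightarrow> bool" where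
  "global_packing \<P> k \<omega> \<longleftrightarrow>
     \<omega> \<in> \<P> \<rightarrow> {1..k} \<and>
     (\<forall>P\<in>\<P>. \<forall>P'\<in>\<P>. P \<noteq> P' \<and> edges P \<inter> edges P' \<noteq> {} \<longrightarrow> \<omega> P \<noteq> \<omega> P')"

text \<open>The ambient graph enters a packing only through the path system, hence is not an argument.\<close>

definition Phi_system :: "'a graph set \<Rightarrow> nat" where
  "Phi_system \<P> = (LEAST k. \<exists>\<omega>. global_packing \<P> k \<omega>)"

definition Phi :: "'a graph \<Rightarrow> nat" where
  "Phi G = (LEAST k. \<exists>\<P>. path_system G \<P> \<and> k = Phi_system \<P>)"

definition cycle_graph :: "nat \<Rightarrow> nat graph" where
  "cycle_graph m = ({0..<m}, {{i, (i + 1) mod m} | i. i < m})"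

end

theory Submission imports Defs begin

text \<open>
  Lower bound: for each \<open>l \<le> n\<close> there are \<open>2n + 1\<close> pairs at distance \<open>l\<close>, so the paths use at
  least \<open>(2n + 1)(1 + \<dots> + n)\<close> edges in total, while a colour class is edge-disjoint and hence
  uses at most \<open>2n + 1\<close> edges.

  Upper bound: take shortest paths, and name the vertices \<open>x\<^sub>1, \<dots>, x\<^sub>n, y\<^sub>1, \<dots>, y\<^sub>n, z\<close> in cyclic
  order. For \<open>1 \<le> s < t \<le> n\<close> the paths \<open>x\<^sub>s x\<^sub>t\<close>, \<open>x\<^sub>t y\<^sub>s\<close>, \<open>y\<^sub>s y\<^sub>t\<close>, \<open>y\<^sub>t x\<^sub>s\<close> tile the cycle, and for
  each \<open>t\<close> so do \<open>x\<^sub>t y\<^sub>t\<close>, \<open>y\<^sub>t z\<close>, \<open>z x\<^sub>t\<close>. These tilings are the colour classes.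
\<close>

section \<open>Length and endpoints of a path, read off from its edge set\<close>

lemma edges_path_of: "edges (path_of xs) = (\<lambda>i. {xs ! i, xs ! Suc i}) ` {i. Suc i < length xs}"
  by (auto simp: path_of_def)

lemma inj_on_path_edge:
  assumes "distinct xs"
  shows "inj_on (\<lambda>i. {xs ! i, xs ! Suc i}) {i. Suc i < length xs}"
  using assms by (auto simp: inj_on_def doubleton_eq_iff nth_eq_iff_index_eq)

lemma card_edges_path_of:
  assumes "distinct xs"
  shows "card (edges (path_of xs)) = length xs - 1"
proof -
  have "{i. Suc i < length xs} = {..<length xs - 1}" by auto
  then show ?thesis
    using card_image[OF inj_on_path_edge[OF assms]] by (simp add: edges_path_of)
qed

text \<open>Distinctness turns the degree of a vertex into a count of edge positions: only
  \<open>i - 1\<close> and \<open>i\<close> can touch \<open>xs ! i\<close>.\<close>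

lemma card_incident_path_edges:
  assumes "distinct xs" "i < length xs"
  shows "card {e \<in> edges (path_of xs). xs ! i \<in> e} = card {k. Suc k < length xs \<and> (k = i \<or> Suc k = i)}"
proof -
  let ?I = "{k. Suc k < length xs \<and> (k = i \<or> Suc k = i)}"
  have "{e \<in> edges (path_of xs). xs ! i \<in> e} = (\<lambda>i. {xs ! i, xs ! Suc i}) ` ?I"
    using assms by (auto simp: edges_path_of nth_eq_iff_index_eq)
  moreover have "inj_on (\<lambda>i. {xs ! i, xs ! Suc i}) ?I"
    by (rule inj_on_subset[OF inj_on_path_edge[OF assms(1)]]) auto
  ultimately show ?thesis by (simp add: card_image)
qed

text \<open>A path is stored without marked ends; they are recovered as its vertices of degree 1,
  inner vertices having degree 2.\<close>

lemma path_of_ends: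
  assumes "distinct xs" "length xs \<ge> 2"
  shows "{hd xs, last xs} = {v. card {e \<in> edges (path_of xs). v \<in> e} = 1}"
proof -
  have deg: "card {k. Suc k < length xs \<and> (k = i \<or> Suc k = i)} = 1 \<longleftrightarrow> i = 0 \<or> i = length xs - 1"
    if "i < length xs" for i
  proof -
    have "{k. Suc k < length xs \<and> (k = i \<or> Suc k = i)} =
        (if i = 0 then {0} else if i = length xs - 1 then {i - 1} else {i - 1, i})"
      using that assms(2) by auto
    then show ?thesis by (auto simp: card_insert_if)
  qed
  have out: "v \<in> set xs" if "card {e \<in> edges (path_of xs). v \<in> e} = 1" for v
  proof -
    from that obtain e where "e \<in> edges (path_of xs)" "v \<in> e"
      by (metis (no_types, lifting) card_1_singletonE insertI1 mem_Collect_eq)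
    then show ?thesis by (auto simp: edges_path_of)
  qed
  have ne: "xs \<noteq> []" using assms(2) by auto
  have ends: "hd xs = xs ! 0" "last xs = xs ! (length xs - 1)"
    using ne by (simp_all add: hd_conv_nth last_conv_nth)
  have "v \<in> {hd xs, last xs} \<longleftrightarrow> card {e \<in> edges (path_of xs). v \<in> e} = 1"
    if "v \<in> set xs" for v
  proof -
    from that obtain i where i: "i < length xs" "v = xs ! i" by (auto simp: in_set_conv_nth)
    have "v \<in> {hd xs, last xs} \<longleftrightarrow> i = 0 \<or> i = length xs - 1"
      using i ne assms(1) by (auto simp: ends nth_eq_iff_index_eq)
    then show ?thesis
      using card_incident_path_edges[OF assms(1) i(1)] deg[OF i(1)] i(2) by simp
  qed
  moreover have "{hd xs, last xs} \<subseteq> set xs" using ne by simp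
  ultimately show ?thesis using out by blast
qed

text \<open>Both pairs equal the set of degree-1 vertices of \<open>P\<close>. Hence different pairs
  always receive different paths, so edge counts over pairs carry over to the set of paths.\<close>

lemma connecting_path_ends_unique:
  assumes "connecting_path G a b P" "connecting_path G' a' b' P" "a \<noteq> b" "a' \<noteq> b'"
  shows "{a, b} = {a', b'}"
proof -
  have "{a, b} = {v. card {e \<in> edges P. v \<in> e} = 1}"
    if "connecting_path G a b P" "a \<noteq> b" for G a b
  proof -
    from that obtain xs where xs: "xs \<noteq> []" "distinct xs" "hd xs = a" "last xs = b" "P = path_of xs"
      unfolding connecting_path_def by auto
    then have "length xs \<ge> 2"
      using that(2) by (cases xs; cases "tl xs") auto
    then show ?thesis using path_of_ends[of xs] xs by simp
  qed
  from this[OF assms(1,3)] this[OF assms(2,4)] show ?thesis by simp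
qed

lemma path_of_rev: "path_of (rev xs) = path_of xs"
proof -
  have sub: "edges (path_of (rev xs)) \<subseteq> edges (path_of xs)" for xs :: "'a list"
  proof
    fix e assume "e \<in> edges (path_of (rev xs))"
    then obtain i where i: "Suc i < length xs" "e = {rev xs ! i, rev xs ! Suc i}"
      by (auto simp: edges_path_of)
    \<comment> \<open>Edge \<open>i\<close> of the reversed list is edge
      \<open>length xs - 2 - i\<close> of the original.\<close>
    let ?j = "length xs - Suc (Suc i)"
    have "Suc ?j < length xs" "e = {xs ! ?j, xs ! Suc ?j}"
      using i by (auto simp: rev_nth Suc_diff_Suc)
    then show "e \<in> edges (path_of xs)" by (auto simp: edges_path_of)
  qed
  from sub[of xs] sub[of "rev xs"] show ?thesis
    by (auto simp: prod_eq_iff) (auto simp: path_of_def)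
qed

lemma connecting_path_sym: "connecting_path G a b P \<Longrightarrow> connecting_path G b a P"
  unfolding connecting_path_def by (metis distinct_rev hd_rev last_rev path_of_rev rev_is_Nil_conv)

section \<open>Existence and edge count of packings\<close>

lemma finite_vertex_pairs:
  assumes "finite (verts G)"
  shows "finite (vertex_pairs G)"
  by (rule finite_subset[of _ "Pow (verts G)"]) (use assms in \<open>auto simp: vertex_pairs_def\<close>)

text \<open>Every path may get its own colour. This ensures that the \<open>LEAST\<close> in
  \<open>Phi_system\<close> is attained.\<close>

lemma ex_global_packing:
  assumes "finite \<P>"
  shows "\<exists>k \<omega>. global_packing \<P> k \<omega>"
proof -
  obtain h where h: "bij_betw h \<P> {1..card \<P>}"
    using ex_bij_betw_nat_finite_1[OF assms] bij_betw_inv by blast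
  have "global_packing \<P> (card \<P>) h"
    unfolding global_packing_def using h by (auto simp: bij_betw_def inj_on_def)
  then show ?thesis by blast
qed

text \<open>Group the paths by colour: the paths of one colour are pairwise edge-disjoint, so
  together they have at most \<open>card E\<close> edges.\<close>

lemma sum_card_edges_le:
  assumes "global_packing \<P> k \<omega>" "finite \<P>" "finite E" "\<And>P. P \<in> \<P> \<Longrightarrow> edges P \<subseteq> E"
  shows "(\<Sum>P\<in>\<P>. card (edges P)) \<le> k * card E"
proof -
  have \<omega>: "\<omega> ` \<P> \<subseteq> {1..k}" using assms(1) by (auto simp: global_packing_def)
  have "(\<Sum>P\<in>\<P>. card (edges P)) = (\<Sum>c\<in>{1..k}. \<Sum>P\<in>{P \<in> \<P>. \<omega> P = c}. card (edges P))"
    by (rule sum.group[OF assms(2) _ \<omega>, symmetric]) simp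
  also have "\<dots> \<le> (\<Sum>c\<in>{1..k}. card E)"
  proof (rule sum_mono)
    fix c
    have "(\<Sum>P\<in>{P \<in> \<P>. \<omega> P = c}. card (edges P)) = card (\<Union>P\<in>{P \<in> \<P>. \<omega> P = c}. edges P)"
    proof (rule card_UN_disjoint[symmetric])
      show "\<forall>P\<in>{P \<in> \<P>. \<omega> P = c}. finite (edges P)"
        using assms(3,4) finite_subset by blast
      show "\<forall>P\<in>{P \<in> \<P>. \<omega> P = c}. \<forall>P'\<in>{P \<in> \<P>. \<omega> P = c}. P \<noteq> P' \<longrightarrow> edges P \<inter> edges P' = {}"
        using assms(1) unfolding global_packing_def by blast
    qed (use assms(2) in simp)
    also have "\<dots> \<le> card E"
      using assms(3,4) by (intro card_mono) auto
    finally show "(\<Sum>P\<in>{P \<in> \<P>. \<omega> P = c}. card (edges P)) \<le> card E" .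
  qed
  finally show ?thesis by simp
qed

subsection \<open>Lower bound\<close>

lemma mod_Suc_less: "(i::nat) < m \<Longrightarrow> (i + 1) mod m = (if i + 1 = m then 0 else i + 1)"
  by auto

definition cyc_dist :: "nat \<Rightarrow> nat \<Rightarrow> nat \<Rightarrow> nat" where
  "cyc_dist m a b = (let d = (if a \<le> b then b - a else a - b) in min d (m - d))"

text \<open>The Lipschitz property of the distance from \<open>a\<close>, which makes a path at
  least as long as the distance between its ends.\<close>

lemma cyc_dist_step:
  assumes "{u, v} \<in> edges (cycle_graph m)" "a < m"
  shows "cyc_dist m a v \<le> Suc (cyc_dist m a u)"
proof -
  obtain i where "i < m" "{u, v} = {i, if i + 1 = m then 0 else i + 1}"
    using assms(1) mod_Suc_less by (auto simp: cycle_graph_def)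
  then have uv: "v = u + 1 \<or> u = v + 1 \<or> u = 0 \<and> v + 1 = m \<or> v = 0 \<and> u + 1 = m" "u < m" "v < m"
    by (auto simp: doubleton_eq_iff split: if_splits)
  define x y where "x = (if a \<le> u then u - a else a - u)" and "y = (if a \<le> v then v - a else a - v)"
  \<comment> \<open>The alternative \<open>x + y + 1 = m\<close> is the edge between
    \<open>m - 1\<close> and \<open>0\<close>, where the differences are \<open>a\<close> and
    \<open>m - 1 - a\<close>.\<close>
  have "x < m" "y < m" "y \<le> x + 1 \<and> x \<le> y + 1 \<or> x + y + 1 = m"
    using uv assms(2) unfolding x_def y_def by auto
  then have "min y (m - y) \<le> Suc (min x (m - x))"
    by (auto simp: min_def)
  then show ?thesis by (simp add: cyc_dist_def x_def y_def Let_def)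
qed

lemma cyc_dist_le_card_edges:
  assumes "connecting_path (cycle_graph m) a b P" "a < m"
  shows "cyc_dist m a b \<le> card (edges P)"
proof -
  obtain xs where xs: "xs \<noteq> []" "distinct xs" "hd xs = a" "last xs = b" "P = path_of xs"
    and sub: "edges (path_of xs) \<subseteq> edges (cycle_graph m)"
    using assms(1) by (auto simp: connecting_path_def subgraph_def)
  have "cyc_dist m a (xs ! i) \<le> i" if "i < length xs" for i
    using that
  proof (induction i)
    case 0
    then show ?case using xs by (simp add: hd_conv_nth[symmetric] cyc_dist_def)
  next
    case (Suc i)
    then have "{xs ! i, xs ! Suc i} \<in> edges (cycle_graph m)"
      using sub by (auto simp: edges_path_of)
    from cyc_dist_step[OF this assms(2)] Suc show ?case by simp
  qed
  from this[of "length xs - 1"] xs show ?thesis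
    by (simp add: card_edges_path_of last_conv_nth)
qed

lemma add_mod_less: "(s::nat) < m \<Longrightarrow> l < m \<Longrightarrow> (s + l) mod m = (if s + l < m then s + l else s + l - m)"
  by (simp add: le_mod_geq)

lemma card_edges_cycle_graph: "card (edges (cycle_graph m)) \<le> m" "finite (edges (cycle_graph m))"
proof -
  have "edges (cycle_graph m) = (\<lambda>i. {i, (i + 1) mod m}) ` {..<m}"
    by (auto simp: cycle_graph_def)
  then show "card (edges (cycle_graph m)) \<le> m" "finite (edges (cycle_graph m))"
    using card_image_le[of "{..<m}" "\<lambda>i. {i, (i + 1) mod m}"] by auto
qed

lemma sum_upto_eq_choose: "(\<Sum>l\<in>{1..n}. l) = (n + 1) choose 2"
  by (induction n) (auto simp: numeral_2_eq_2)

lemma packing_cycle_lower: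
  assumes "path_system (cycle_graph (2 * n + 1)) \<P>" "global_packing \<P> k \<omega>"
  shows "(n + 1) choose 2 \<le> k"
proof -
  let ?m = "2 * n + 1" and ?G = "cycle_graph (2 * n + 1)"
  let ?I = "{..<?m} \<times> {1..n}"
  have V: "verts ?G = {0..<?m}" by (simp add: cycle_graph_def)
  obtain p where p0: "\<forall>a\<in>{..<?m}. \<forall>b\<in>{..<?m}. a \<noteq> b \<longrightarrow> connecting_path ?G a b (p {a, b})"
    and \<P>: "\<P> = p ` vertex_pairs ?G"
    using assms(1) unfolding path_system_def V atLeast0LessThan by blast
  have p: "connecting_path ?G a b (p {a, b})" if "a < ?m" "b < ?m" "a \<noteq> b" for a b
    using p0 that by blast
  have fin: "finite \<P>" using finite_vertex_pairs[of ?G] V by (simp add: \<P>)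
  have sub: "edges P \<subseteq> edges ?G" if "P \<in> \<P>" for P
  proof -
    from that obtain a b where "a < ?m" "b < ?m" "a \<noteq> b" "P = p {a, b}"
      unfolding \<P> vertex_pairs_def V by auto
    then show ?thesis using p[of a b] by (auto simp: connecting_path_def subgraph_def)
  qed
  \<comment> \<open>The pair at distance \<open>l\<close> is named by the end \<open>s\<close> from
    which \<open>l\<close> forward steps lead to the other end.\<close>
  define q where "q = (\<lambda>(s, l). p {s, (s + l) mod ?m})"
  have path: "connecting_path ?G s ((s + l) mod ?m) (q (s, l))" "s \<noteq> (s + l) mod ?m"
    if "(s, l) \<in> ?I" for s l
  proof -
    show ne: "s \<noteq> (s + l) mod ?m" using that add_mod_less[of s ?m l] by auto
    show "connecting_path ?G s ((s + l) mod ?m) (q (s, l))"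
      unfolding q_def using that p[OF _ _ ne] by simp
  qed
  have inj: "inj_on q ?I"
  proof (rule inj_onI, clarify)
    fix s l s' l' assume "s < ?m" "l \<in> {1..n}" "s' < ?m" "l' \<in> {1..n}" "q (s, l) = q (s', l')"
    then have "{s, (s + l) mod ?m} = {s', (s' + l') mod ?m}"
      using path[of s l] path[of s' l'] connecting_path_ends_unique by (metis SigmaI lessThan_iff)
    \<comment> \<open>If the ends matched crosswise, \<open>l + l'\<close> would be a multiple of
      \<open>2 * n + 1\<close>, but it lies between \<open>2\<close> and
      \<open>2 * n\<close>.\<close>
    then show "s = s' \<and> l = l'"
      using \<open>s < ?m\<close> \<open>l \<in> _\<close> \<open>s' < ?m\<close> \<open>l' \<in> _\<close> add_mod_less[of s ?m l] add_mod_less[of s' ?m l']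
      by (auto simp: doubleton_eq_iff split: if_splits)
  qed
  have img: "q ` ?I \<subseteq> \<P>"
  proof (rule image_subsetI, clarify)
    fix s l assume "s < ?m" "l \<in> {1..n}"
    then have "{s, (s + l) mod ?m} \<in> vertex_pairs ?G"
      using path(2)[of s l] unfolding vertex_pairs_def V mem_Collect_eq
      by (intro exI[of _ s] exI[of _ "(s + l) mod ?m"]) simp
    then show "q (s, l) \<in> \<P>" by (simp add: q_def \<P>)
  qed
  have "?m * ((n + 1) choose 2) = (\<Sum>s<?m. \<Sum>l\<in>{1..n}. l)"
    unfolding sum_upto_eq_choose by simp
  also have "\<dots> = (\<Sum>(s, l)\<in>?I. l)" by (rule sum.cartesian_product)
  also have "\<dots> \<le> (\<Sum>x\<in>?I. card (edges (q x)))"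
  proof (rule sum_mono, clarify)
    fix s l assume sl: "s < ?m" "l \<in> {1..n}"
    then have "cyc_dist ?m s ((s + l) mod ?m) = l"
      using add_mod_less[of s ?m l] by (auto simp: cyc_dist_def Let_def)
    then show "l \<le> card (edges (q (s, l)))"
      using cyc_dist_le_card_edges[OF path(1), of s l] sl by simp
  qed
  also have "\<dots> = (\<Sum>P\<in>q ` ?I. card (edges P))"
    by (simp only: sum.reindex[OF inj] comp_def)
  also have "\<dots> \<le> (\<Sum>P\<in>\<P>. card (edges P))"
    by (rule sum_mono2[OF fin img]) simp
  also have "\<dots> \<le> k * card (edges ?G)"
    using sum_card_edges_le[OF assms(2) fin _ sub] card_edges_cycle_graph(2) by blast
  also have "\<dots> \<le> k * ?m" by (intro mult_left_mono card_edges_cycle_graph(1)) simp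
  finally have "((n + 1) choose 2) * ?m \<le> k * ?m" by (simp only: mult.commute)
  then show ?thesis unfolding mult_le_cancel2 by simp
qed

subsection \<open>Upper bound\<close>

definition arc :: "nat \<Rightarrow> nat \<Rightarrow> nat \<Rightarrow> nat list" where
  "arc m s l = map (\<lambda>k. (s + k) mod m) [0..<Suc l]"

text \<open>Factoring through the index of each edge's first vertex reduces questions about edges to
  sets of numbers.\<close>

lemma edges_arc:
  "edges (path_of (arc m s l)) = (\<lambda>k. {k, (k + 1) mod m}) ` (\<lambda>k. (s + k) mod m) ` {..<l}"
proof -
  have "edges (path_of (arc m s l)) = (\<lambda>i. {arc m s l ! i, arc m s l ! Suc i}) ` {..<l}"
    by (auto simp: edges_path_of arc_def)
  also have "\<dots> = (\<lambda>i. {(s + i) mod m, ((s + i) mod m + 1) mod m}) ` {..<l}"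
    by (intro image_cong) (auto simp: arc_def mod_simps simp del: upt_Suc)
  finally show ?thesis by (simp add: image_image)
qed

lemma connecting_path_arc:
  assumes "s < m" "l < m"
  shows "connecting_path (cycle_graph m) s ((s + l) mod m) (path_of (arc m s l))"
  unfolding connecting_path_def
proof (intro exI conjI)
  show "distinct (arc m s l)"
    using assms add_mod_less[of s m]
    by (auto simp: arc_def distinct_map inj_on_def split: if_splits simp del: upt_Suc)
  show "hd (arc m s l) = s" "last (arc m s l) = (s + l) mod m" "arc m s l \<noteq> []"
    using assms by (auto simp: arc_def hd_map last_map simp del: upt_Suc)
  have "edges (path_of (arc m s l)) \<subseteq> edges (cycle_graph m)"
    unfolding edges_arc using assms by (auto simp: cycle_graph_def)
  moreover have "verts (path_of (arc m s l)) \<subseteq> verts (cycle_graph m)"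
    using assms by (auto simp: path_of_def arc_def cycle_graph_def simp del: upt_Suc)
  ultimately show "subgraph (path_of (arc m s l)) (cycle_graph m)"
    by (simp add: subgraph_def)
qed simp

text \<open>Allows a common edge to be treated as a common index. For \<open>m = 2\<close> this
  fails, as both indices name the edge between \<open>0\<close> and \<open>1\<close>.\<close>

lemma inj_on_cycle_edge:
  fixes m :: nat
  assumes "m \<ge> 3"
  shows "inj_on (\<lambda>k. {k, (k + 1) mod m}) {..<m}"
proof (rule inj_onI)
  fix i j assume "i \<in> {..<m}" "j \<in> {..<m}" "{i, (i + 1) mod m} = {j, (j + 1) mod m}"
  then show "i = j"
    using assms mod_Suc_less[of i m] mod_Suc_less[of j m]
    by (auto simp: doubleton_eq_iff split: if_splits)
qed

text \<open>Meant for \<open>i < j\<close>: the arc not longer than \<open>n\<close>, running either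
  from \<open>i\<close> up to \<open>j\<close> or from \<open>j\<close> through \<open>2 * n\<close>
  round to \<open>i\<close>. As the cycle is odd, there are no ties.\<close>

definition short_arc :: "nat \<Rightarrow> nat \<Rightarrow> nat \<Rightarrow> nat list" where
  "short_arc n i j = (if j \<le> i + n then arc (2 * n + 1) i (j - i)
                      else arc (2 * n + 1) j (2 * n + 1 - (j - i)))"

text \<open>Edges are represented by indices: \<open>k\<close> stands for the edge from \<open>k\<close> to its successor.\<close>

definition short_arc_edges :: "nat \<Rightarrow> nat \<Rightarrow> nat \<Rightarrow> nat set" where
  "short_arc_edges n i j = (if j \<le> i + n then {i..<j} else {j..<2 * n + 1} \<union> {..<i})"

lemma connecting_path_short_arc:
  assumes "i < j" "j < 2 * n + 1"
  shows "connecting_path (cycle_graph (2 * n + 1)) i j (path_of (short_arc n i j))"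
proof (cases "j \<le> i + n")
  case True
  then show ?thesis
    using assms connecting_path_arc[of i "2 * n + 1" "j - i"] by (simp add: short_arc_def)
next
  case False
  have "(j + (2 * n + 1 - (j - i))) mod (2 * n + 1) = i"
    using assms add_mod_less[of j "2 * n + 1" "2 * n + 1 - (j - i)"] by simp
  then show ?thesis
    using False assms connecting_path_arc[of j "2 * n + 1" "2 * n + 1 - (j - i)"]
    by (simp add: short_arc_def connecting_path_sym)
qed

lemma edges_short_arc:
  assumes "i < j" "j < 2 * n + 1"
  shows "edges (path_of (short_arc n i j)) =
    (\<lambda>k. {k, (k + 1) mod (2 * n + 1)}) ` short_arc_edges n i j"
proof (cases "j \<le> i + n")
  case True
  have "(\<lambda>k. (i + k) mod (2 * n + 1)) ` {..<j - i} = (\<lambda>k. i + k) ` {..<j - i}"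
    using assms by (intro image_cong) auto
  also have "\<dots> = {i..<j}"
    using assms by (simp add: lessThan_atLeast0)
  finally show ?thesis
    using True assms by (simp add: short_arc_def short_arc_edges_def edges_arc)
next
  case False
  let ?m = "2 * n + 1"
  have "(\<lambda>k. (j + k) mod ?m) ` {..<?m - (j - i)} = {j..<?m} \<union> {..<i}"
  proof (intro equalityI subsetI)
    fix x assume "x \<in> (\<lambda>k. (j + k) mod ?m) ` {..<?m - (j - i)}"
    then obtain k where "k < ?m - (j - i)" "x = (j + k) mod ?m" by auto
    then show "x \<in> {j..<?m} \<union> {..<i}"
      using assms add_mod_less[of j ?m k] by (auto split: if_splits)
  next
    fix x assume x: "x \<in> {j..<?m} \<union> {..<i}"
    \<comment> \<open>\<open>k\<close> counts forward steps from \<open>j\<close>; indices below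
      \<open>i\<close> come after the wrap at \<open>2 * n + 1\<close>.\<close>
    define k where "k = (if j \<le> x then x - j else ?m - j + x)"
    have "k < ?m - (j - i)" "x = (j + k) mod ?m"
      using x assms add_mod_less[of j ?m k] by (auto simp: k_def split: if_splits)
    then show "x \<in> (\<lambda>k. (j + k) mod ?m) ` {..<?m - (j - i)}" by auto
  qed
  then show ?thesis
    using False assms by (simp add: short_arc_def short_arc_edges_def edges_arc)
qed

section \<open>Colouring the pairs by tilings\<close>

text \<open>
  With \<open>x\<^sub>t = t - 1\<close>, \<open>y\<^sub>t = n + t - 1\<close> and \<open>z = 2n\<close>, the level of \<open>x\<^sub>t\<close> and \<open>y\<^sub>t\<close> is \<open>t\<close>, and that
  of \<open>z\<close> is \<open>0\<close>; so the antipodal pairs \<open>x\<^sub>t y\<^sub>t\<close> share their colour with the pairs containing \<open>z\<close>.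
\<close>

definition level :: "nat \<Rightarrow> nat \<Rightarrow> nat" where
  "level n i = (if i < n then i + 1 else if i < 2 * n then i - n + 1 else 0)"

text \<open>A colour \<open>(t, s)\<close> names a tiling: for \<open>s = 0\<close> the one cut at
  \<open>x\<^sub>t\<close>, \<open>y\<^sub>t\<close>, \<open>z\<close>, for
  \<open>1 \<le> s < t\<close> the one cut at \<open>x\<^sub>s\<close>, \<open>x\<^sub>t\<close>,
  \<open>y\<^sub>s\<close>, \<open>y\<^sub>t\<close>.\<close>

definition pair_colour :: "nat \<Rightarrow> nat \<Rightarrow> nat \<Rightarrow> nat \<times> nat" where
  "pair_colour n i j = (if level n i = level n j then (level n i, 0)
     else (max (level n i) (level n j), min (level n i) (level n j)))"

lemma pair_colour_mem:
  assumes "i < j" "j < 2 * n + 1"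
  shows "pair_colour n i j \<in> (SIGMA t:{1..n}. {..<t})"
  using assms by (auto simp: pair_colour_def level_def max_def min_def)

text \<open>Lists the three or four sides of the tiling \<open>(t, s)\<close>. Adding 1 to the
  vertices avoids truncated subtraction.\<close>

lemma pair_colour_cases:
  assumes "i < j" "j < 2 * n + 1" "pair_colour n i j = (t, s)"
  shows "s = 0 \<and> 1 \<le> t \<and> t \<le> n \<and>
      (i + 1 = t \<and> j + 1 = n + t \<or> i + 1 = n + t \<and> j = 2 * n \<or> i + 1 = t \<and> j = 2 * n)
    \<or> 1 \<le> s \<and> s < t \<and> t \<le> n \<and>
      (i + 1 = s \<and> j + 1 = t \<or> i + 1 = t \<and> j + 1 = n + s \<or>
       i + 1 = n + s \<and> j + 1 = n + t \<or> i + 1 = s \<and> j + 1 = n + t)"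
proof -
  \<comment> \<open>A pair of an x and a y is split by comparing \<open>j\<close> with
    \<open>i + n\<close>, which decides both which level is larger and whether the short arc
    wraps.\<close>
  consider "j < n" | "i < n" "n \<le> j" "j < i + n" | "i < n" "j = i + n"
    | "i < n" "i + n < j" "j < 2 * n" | "i < n" "j = 2 * n"
    | "n \<le> i" "j < 2 * n" | "n \<le> i" "j = 2 * n"
    using assms(1,2) by linarith
  then show ?thesis
  proof cases
    case 1
    then have "pair_colour n i j = (j + 1, i + 1)"
      using assms(1) by (simp add: pair_colour_def level_def)
    with 1 assms(1,3) show ?thesis by simp
  next
    case 2
    then have "pair_colour n i j = (i + 1, j - n + 1)"
      by (simp add: pair_colour_def level_def)
    with 2 assms(3) show ?thesis by auto
  next
    case 3
    then have "pair_colour n i j = (i + 1, 0)"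
      by (simp add: pair_colour_def level_def)
    with 3 assms(3) show ?thesis by auto
  next
    case 4
    then have "pair_colour n i j = (j - n + 1, i + 1)"
      by (simp add: pair_colour_def level_def)
    with 4 assms(3) show ?thesis by auto
  next
    case 5
    then have "pair_colour n i j = (i + 1, 0)"
      by (simp add: pair_colour_def level_def)
    with 5 assms(3) show ?thesis by auto
  next
    case 6
    then have "pair_colour n i j = (j - n + 1, i - n + 1)"
      using assms(1) by (simp add: pair_colour_def level_def)
    with 6 assms(1,3) show ?thesis by auto
  next
    case 7
    then have "pair_colour n i j = (i - n + 1, 0)"
      using assms(1) by (simp add: pair_colour_def level_def)
    with 7 assms(1,3) show ?thesis by auto
  qed
qed

text \<open>Attaches to each side its range of edge indices. For fixed \<open>(t, s)\<close> these
  ranges are disjoint intervals, up to wrapping.\<close>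

lemma pair_colour_edge_cases:
  assumes "i < j" "j < 2 * n + 1" "pair_colour n i j = (t, s)" "k \<in> short_arc_edges n i j"
  shows "s = 0 \<and> 1 \<le> t \<and> t \<le> n \<and>
      (i + 1 = t \<and> j + 1 = n + t \<and> t \<le> k + 1 \<and> k + 1 < n + t \<or>
       i + 1 = n + t \<and> j = 2 * n \<and> n + t \<le> k + 1 \<and> k < 2 * n \<or>
       i + 1 = t \<and> j = 2 * n \<and> (k + 1 < t \<or> k = 2 * n))
    \<or> 1 \<le> s \<and> s < t \<and> t \<le> n \<and>
      (i + 1 = s \<and> j + 1 = t \<and> s \<le> k + 1 \<and> k + 1 < t \<or>
       i + 1 = t \<and> j + 1 = n + s \<and> t \<le> k + 1 \<and> k + 1 < n + s \<or>
       i + 1 = n + s \<and> j + 1 = n + t \<and> n + s \<le> k + 1 \<and> k + 1 < n + t \<or>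
       i + 1 = s \<and> j + 1 = n + t \<and> (n + t \<le> k + 1 \<or> k + 1 < s))"
proof -
  have "j \<le> i + n \<and> i \<le> k \<and> k < j \<or> i + n < j \<and> (j \<le> k \<and> k < 2 * n + 1 \<or> k < i)"
    using assms(4) by (auto simp: short_arc_edges_def split: if_splits)
  with pair_colour_cases[OF assms(1-3)] show ?thesis
    by (elim disjE conjE) simp_all
qed

text \<open>An index lies on only one side of a given tiling; every mismatched choice of sides
  contradicts linear arithmetic.\<close>

lemma pair_colour_disjoint:
  assumes "i < j" "j < 2 * n + 1" "i' < j'" "j' < 2 * n + 1"
    and "pair_colour n i j = pair_colour n i' j'"
    and "k \<in> short_arc_edges n i j" "k \<in> short_arc_edges n i' j'"
  shows "i = i' \<and> j = j'"
proof -
  obtain t s where c: "pair_colour n i j = (t, s)" by fastforce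
  with assms(5) have c': "pair_colour n i' j' = (t, s)" by simp
  from pair_colour_edge_cases[OF assms(1,2) c assms(6)]
    pair_colour_edge_cases[OF assms(3,4) c' assms(7)]
  show ?thesis by (elim disjE conjE; intro conjI; linarith)
qed

lemma card_colours: "card (SIGMA t:{1..n}. {..<t}) = (n + 1) choose 2"
  using sum_upto_eq_choose[of n] by simp

lemma packing_cycle_upper:
  assumes "n \<ge> 1"
  shows "\<exists>\<P> \<omega>. path_system (cycle_graph (2 * n + 1)) \<P> \<and> global_packing \<P> ((n + 1) choose 2) \<omega>"
proof -
  let ?m = "2 * n + 1" and ?G = "cycle_graph (2 * n + 1)"
  let ?C = "SIGMA t:{1..n}. {..<t}"
  have V: "verts ?G = {0..<?m}" by (simp add: cycle_graph_def)
  \<comment> \<open>\<open>Min\<close> and \<open>Max\<close> put the unordered pair into the order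
    \<open>i < j\<close> that \<open>short_arc\<close> expects.\<close>
  define p where "p A = path_of (short_arc n (Min A) (Max A))" for A
  define \<P> where "\<P> = p ` vertex_pairs ?G"
  have conn: "connecting_path ?G a b (p {a, b})" if "a < ?m" "b < ?m" "a \<noteq> b" for a b
    using that connecting_path_short_arc[of a b n] connecting_path_short_arc[of b a n]
    by (cases "a < b") (auto simp: p_def min_def max_def connecting_path_sym)
  then have sys: "path_system ?G \<P>"
    unfolding path_system_def \<P>_def V by (intro exI[of _ p]) simp
  have "\<exists>i j. i < j \<and> j < ?m \<and> P = path_of (short_arc n i j)" if "P \<in> \<P>" for P
  proof -
    from that obtain a b where "a < ?m" "b < ?m" "a \<noteq> b" "P = p {a, b}"
      unfolding \<P>_def vertex_pairs_def V by auto
    then show ?thesis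
      by (intro exI[of _ "min a b"] exI[of _ "max a b"]) (auto simp: p_def)
  qed
  \<comment> \<open>Colours must be assigned to paths, so ends \<open>u P < v P\<close> are chosen
    for each path.\<close>
  then obtain u v where uv: "\<And>P. P \<in> \<P> \<Longrightarrow> u P < v P" "\<And>P. P \<in> \<P> \<Longrightarrow> v P < ?m"
      "\<And>P. P \<in> \<P> \<Longrightarrow> P = path_of (short_arc n (u P) (v P))"
    by metis
  have "finite ?C" by simp
  \<comment> \<open>\<open>h\<close> numbers the colours \<open>(t, s)\<close>, of which there are
    \<open>1 + ... + n\<close>.\<close>
  then obtain h where h: "bij_betw h ?C {1..(n + 1) choose 2}"
    using ex_bij_betw_nat_finite_1 card_colours bij_betw_inv by metis
  define \<omega> where "\<omega> P = h (pair_colour n (u P) (v P))" for P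
  have mem: "pair_colour n (u P) (v P) \<in> ?C" if "P \<in> \<P>" for P
    using pair_colour_mem uv that by blast
  have "\<omega> \<in> \<P> \<rightarrow> {1..(n + 1) choose 2}"
    using mem h unfolding \<omega>_def by (blast dest: bij_betwE)
  moreover have "P = P'"
    if P: "P \<in> \<P>" "P' \<in> \<P>" and meet: "edges P \<inter> edges P' \<noteq> {}" and eq: "\<omega> P = \<omega> P'" for P P'
  proof -
    let ?S = "short_arc_edges n (u P) (v P)" and ?S' = "short_arc_edges n (u P') (v P')"
    let ?e = "\<lambda>k. {k, (k + 1) mod ?m}"
    have "edges Q = ?e ` short_arc_edges n (u Q) (v Q)" if "Q \<in> \<P>" for Q
      using arg_cong[OF uv(3)[OF that], of edges] edges_short_arc[OF uv(1)[OF that] uv(2)[OF that]]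
      by (rule trans)
    then have "?e ` ?S \<inter> ?e ` ?S' \<noteq> {}" using meet P by simp
    moreover have "?S \<subseteq> {..<?m}" "?S' \<subseteq> {..<?m}"
      using uv(1,2)[OF P(1)] uv(1,2)[OF P(2)] by (auto simp: short_arc_edges_def)
    moreover have "inj_on ?e {..<?m}" using inj_on_cycle_edge[of ?m] assms by simp
    ultimately have "?S \<inter> ?S' \<noteq> {}"
      using inj_on_image_Int[of ?e "{..<?m}" ?S ?S'] by (metis image_empty)
    then obtain k where "k \<in> ?S" "k \<in> ?S'" by blast
    moreover have "pair_colour n (u P) (v P) = pair_colour n (u P') (v P')"
      using eq mem[OF P(1)] mem[OF P(2)] h unfolding \<omega>_def by (metis bij_betw_def inj_onD)
    ultimately have "u P = u P' \<and> v P = v P'"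
      using pair_colour_disjoint uv(1,2) P by blast
    then show ?thesis using uv(3) P by metis
  qed
  ultimately have "global_packing \<P> ((n + 1) choose 2) \<omega>"
    unfolding global_packing_def by blast
  with sys show ?thesis by blast
qed

theorem theorem2:
  fixes n :: nat
  assumes "n \<ge> 1"
  shows "Phi (cycle_graph (2 * n + 1)) = (n + 1) choose 2"
proof -
  let ?G = "cycle_graph (2 * n + 1)"
  have lower: "(n + 1) choose 2 \<le> Phi_system \<P>" if "path_system ?G \<P>" for \<P>
  proof -
    \<comment> \<open>Finiteness provides some packing, so the minimum
      \<open>Phi_system \<P>\<close> is realised and the lower bound applies to it.\<close>
    have "finite \<P>"
      using that finite_vertex_pairs[of ?G] by (auto simp: path_system_def cycle_graph_def)
    then have "\<exists>\<omega>. global_packing \<P> (Phi_system \<P>) \<omega>"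
      unfolding Phi_system_def by (rule LeastI_ex[OF ex_global_packing])
    then show ?thesis using packing_cycle_lower[OF that] by blast
  qed
  obtain \<P> \<omega> where \<P>: "path_system ?G \<P>" "global_packing \<P> ((n + 1) choose 2) \<omega>"
    using packing_cycle_upper[OF assms] by blast
  then have "Phi_system \<P> \<le> (n + 1) choose 2"
    unfolding Phi_system_def by (blast intro: Least_le)
  with lower[OF \<P>(1)] have "Phi_system \<P> = (n + 1) choose 2" by simp
  then show ?thesis
    unfolding Phi_def using \<P>(1) lower by (intro Least_equality) auto
qed

end
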